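(* Let $K$ be a countably infinite field, $(F_N)_{N\in\mathbb{N}}$ a double F\o lner sequence in $K$, and $p(x)\in K[x]$ a non-constant polynomial which is admissible for $K$. Then for any finite colouring $K=C_1\cup\dots\cup C_r$ ($r\in\mathbb{N}$) there exists a colour $C_j$, $1\le j\le r$, such that $$\overline{d}_{(F_N)}\Big(\big\{u\in C_j:\ \overline{d}_{(F_N)}\big(\{v\in K:\ \{u,\,p(u)+v,\,uv\}\subset C_j\}\big)>0\big\}\Big)>0 .$$
   Context: For a countable field $K$, a double F\o lner sequence in $K$ is a sequence $(F_N)_{N\in\mathbb{N}}$ of non-empty finite subsets of $K$ such that for every $x\in K^*=K\setminus\{0\}$, $\lim_{N\to\infty}\frac{|F_N\cap(x+F_N)|}{|F_N|}=\lim_{N\to\infty}\frac{|F_N\cap(xF_N)|}{|F_N|}=1$. For $E\subset K$, the upper density is $\overline{d}_{(F_N)}(E)=\limsup_{N\to\infty}\frac{|E\cap F_N|}{|F_N|}$. A non-constant polynomial $p(x)\in K[x]$ is admissible for $K$ if either $\operatorname{char}(K)=0$, or $\operatorname{char}(K)=q$ is prime and $\deg(p(x))\le q-1$. *)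

theory Defs
  imports "HOL-Analysis.Analysis" "HOL-Computational_Algebra.Computational_Algebra"
begin

definition double_Folner :: "(nat \<Rightarrow> 'a::field set) \<Rightarrow> bool" where
  "double_Folner F \<longleftrightarrow>
     (\<forall>N. finite (F N) \<and> F N \<noteq> {}) \<and>
     (\<forall>x. x \<noteq> 0 \<longrightarrow>
        (\<lambda>N. real (card (F N \<inter> (\<lambda>y. x + y) ` F N)) / real (card (F N))) \<longlonglongrightarrow> 1 \<and>
        (\<lambda>N. real (card (F N \<inter> (\<lambda>y. x * y) ` F N)) / real (card (F N))) \<longlonglongrightarrow> 1)"

text \<open>The limit superior is taken in the extended reals because \<^const>\<open>limsup\<close> needs a
  complete lattice; for finite non-empty \<open>F N\<close> its value lies between 0 and 1.\<close>

definition upper_density :: "(nat \<Rightarrow> 'a set) \<Rightarrow> 'a set \<Rightarrow> ereal" where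
  "upper_density F E = limsup (\<lambda>N. ereal (real (card (E \<inter> F N)) / real (card (F N))))"

definition admissible :: "'a::field poly \<Rightarrow> bool" where
  "admissible p \<longleftrightarrow> degree p > 0 \<and>
     (CHAR('a) = 0 \<or> (prime CHAR('a) \<and> degree p \<le> CHAR('a) - 1))"

end

theory Submission
  imports Defs
begin

text \<open>
  Let \<open>m\<close> be a mean on the bounded functions on the field, obtained as a limit of the averages
  over \<open>F N\<close> along an ultrafilter. It is invariant under all maps \<open>x \<mapsto> a * x + b\<close> with \<open>a \<noteq> 0\<close>, and
  sets of positive mean have positive upper density.

  The heart of the proof is a recurrence theorem, \<open>affine_recurrence\<close>. For an invariant mean
  \<open>L\<close> on a space with an action of the affine group and a function \<open>f\<close> with values between \<open>-1\<close> and
  \<open>1\<close>, the mean over \<open>u\<close> and \<open>v\<close> of \<open>f(u v) f(v + p(u))\<close> is at least the square of the mean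
  of \<open>f\<close>. In a Hilbert space this would read as follows: the part of \<open>f\<close> orthogonal to the
  translation invariant functions contributes nothing, by van der Corput's trick applied to dilations
  of \<open>u\<close> and then to translations of \<open>u\<close>; on the invariant part the shift by \<open>p(u)\<close> has no effect, and
  averaging over the remaining dilations is positive definite. Here the projections are replaced by
  averages of translates with almost minimal mean square, which are almost invariant uniformly in the
  translation (\<open>almost_invariant_halving\<close>). The vanishing of the orthogonal part becomes an exact
  statement about coboundaries \<open>f(v) - f(v + y)\<close> (\<open>twisted_shift_annihilates\<close>). Admissibility of \<open>p\<close> ensures
  that differences of \<open>p\<close> stay non-constant down to degree one.

  Recurrence for a single colour would not put \<open>u\<close> into that colour. Therefore it is applied to the
  product of all colour classes of positive mean, in a power of the field with the diagonal action.
  The resulting \<open>u\<close> of positive mean are good for all these colours at the same time, in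
  particular for their own colour, as the colours of mean zero cover only a set of mean zero. Finitely many
  colours then leave one \<open>C j\<close> whose good \<open>u\<close> have positive mean.
\<close>

section \<open>Means on bounded functions\<close>

definition bdd_fn :: "('x \<Rightarrow> real) \<Rightarrow> bool" where
  "bdd_fn f \<longleftrightarrow> (\<exists>B. \<forall>x. \<bar>f x\<bar> \<le> B)"

lemma bdd_fnI: "(\<And>x. \<bar>f x\<bar> \<le> B) \<Longrightarrow> bdd_fn f"
  by (auto simp: bdd_fn_def)

lemma bdd_fnE:
  assumes "bdd_fn f"
  obtains B where "B > 0" and "\<And>x. \<bar>f x\<bar> \<le> B"
proof -
  from assms obtain B where B: "\<And>x. \<bar>f x\<bar> \<le> B" by (auto simp: bdd_fn_def)
  have "\<bar>f x\<bar> \<le> \<bar>B\<bar> + 1" for x using B[of x] by linarith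
  then show ?thesis by (intro that[of "\<bar>B\<bar> + 1"]) auto
qed

lemma bdd_fn_const: "bdd_fn (\<lambda>x. c)"
  by (rule bdd_fnI[of _ "\<bar>c\<bar>"]) simp

lemma bdd_fn_add: 
  assumes "bdd_fn f" and "bdd_fn g"
  shows "bdd_fn (\<lambda>x. f x + g x)"
proof -
  from assms(1) obtain B where B: "\<And>x. \<bar>f x\<bar> \<le> B" by (auto simp: bdd_fn_def)
  from assms(2) obtain D where D: "\<And>x. \<bar>g x\<bar> \<le> D" by (auto simp: bdd_fn_def)
  show ?thesis
  proof (rule bdd_fnI)
    fix x show "\<bar>f x + g x\<bar> \<le> B + D" using B[of x] D[of x] by linarith
  qed
qed

lemma bdd_fn_mult: 
  assumes "bdd_fn f" and "bdd_fn g"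
  shows "bdd_fn (\<lambda>x. f x * g x)"
proof -
  from assms(1) obtain B where B: "B > 0" "\<And>x. \<bar>f x\<bar> \<le> B" by (erule bdd_fnE)
  from assms(2) obtain D where D: "D > 0" "\<And>x. \<bar>g x\<bar> \<le> D" by (erule bdd_fnE)
  show ?thesis
  proof (rule bdd_fnI)
    fix x show "\<bar>f x * g x\<bar> \<le> B * D"
      unfolding abs_mult using B D by (intro mult_mono) (auto simp: less_imp_le)
  qed
qed

lemma bdd_fn_minus: "bdd_fn f \<Longrightarrow> bdd_fn (\<lambda>x. - f x)"
  using bdd_fn_mult[OF bdd_fn_const[of "-1"], of f] by simp

lemma bdd_fn_diff: "bdd_fn f \<Longrightarrow> bdd_fn g \<Longrightarrow> bdd_fn (\<lambda>x. f x - g x)"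
  using bdd_fn_add[OF _ bdd_fn_minus, of f g] by simp

lemma bdd_fn_divide: "bdd_fn f \<Longrightarrow> bdd_fn (\<lambda>x. f x / c)"
  using bdd_fn_mult[OF bdd_fn_const[of "1/c"], of f] by simp

lemma bdd_fn_power: "bdd_fn f \<Longrightarrow> bdd_fn (\<lambda>x. f x ^ n)"
  by (induction n) (auto intro: bdd_fn_const bdd_fn_mult)

lemma bdd_fn_sum: "(\<And>i. i \<in> I \<Longrightarrow> bdd_fn (f i)) \<Longrightarrow> bdd_fn (\<lambda>x. \<Sum>i\<in>I. f i x)"
  by (induction I rule: infinite_finite_induct) (auto intro: bdd_fn_const bdd_fn_add)

lemma bdd_fn_comp: "bdd_fn f \<Longrightarrow> bdd_fn (\<lambda>x. f (g x))"
  by (auto simp: bdd_fn_def)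

lemma bdd_fn_indicator: "bdd_fn (indicat_real E)"
  by (rule bdd_fnI[of _ 1]) (auto simp: indicator_def)

lemmas bdd_fn_intros = bdd_fn_const bdd_fn_add bdd_fn_mult bdd_fn_minus bdd_fn_diff
  bdd_fn_divide bdd_fn_power bdd_fn_sum

locale mean =
  fixes M :: "('x \<Rightarrow> real) \<Rightarrow> real"
  assumes add: "bdd_fn f \<Longrightarrow> bdd_fn g \<Longrightarrow> M (\<lambda>x. f x + g x) = M f + M g"
    and scale: "bdd_fn f \<Longrightarrow> M (\<lambda>x. c * f x) = c * M f"
    and nonneg: "bdd_fn f \<Longrightarrow> (\<And>x. 0 \<le> f x) \<Longrightarrow> 0 \<le> M f"
    and one: "M (\<lambda>x. 1) = 1"
begin

lemma const: "M (\<lambda>x. c) = c"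
  using scale[OF bdd_fn_const[of 1], of c] one by simp

lemma diff: "bdd_fn f \<Longrightarrow> bdd_fn g \<Longrightarrow> M (\<lambda>x. f x - g x) = M f - M g"
  using add[of f "\<lambda>x. (-1) * g x"] scale[of g "-1"] bdd_fn_minus[of g] by simp

lemma sum: "finite I \<Longrightarrow> (\<And>i. i \<in> I \<Longrightarrow> bdd_fn (f i)) \<Longrightarrow>
    M (\<lambda>x. \<Sum>i\<in>I. f i x) = (\<Sum>i\<in>I. M (f i))"
  by (induction I rule: finite_induct) (auto simp: const add bdd_fn_sum)

lemma mono: "bdd_fn f \<Longrightarrow> bdd_fn g \<Longrightarrow> (\<And>x. f x \<le> g x) \<Longrightarrow> M f \<le> M g"
  using nonneg[of "\<lambda>x. g x - f x"] diff[of g f] bdd_fn_diff[of g f] by simp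

lemma abs_le:
  assumes "\<And>x. \<bar>f x\<bar> \<le> B"
  shows "\<bar>M f\<bar> \<le> B"
proof -
  have f: "bdd_fn f" using assms by (rule bdd_fnI)
  have b: "f x \<le> B" "- B \<le> f x" for x using assms[of x] by linarith+
  have "M f \<le> M (\<lambda>x. B)" by (intro mono f bdd_fn_const b)
  moreover have "M (\<lambda>x. - B) \<le> M f" by (intro mono f bdd_fn_const b)
  ultimately show ?thesis by (simp add: const)
qed

lemma Cauchy_Schwarz:
  assumes f: "bdd_fn f" and g: "bdd_fn g"
  shows "(M (\<lambda>x. f x * g x))\<^sup>2 \<le> M (\<lambda>x. (f x)\<^sup>2) * M (\<lambda>x. (g x)\<^sup>2)"
proof -
  define a where "a = M (\<lambda>x. (f x)\<^sup>2)"
  define b where "b = M (\<lambda>x. f x * g x)"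
  define c where "c = M (\<lambda>x. (g x)\<^sup>2)"
  have q: "0 \<le> a + 2 * t * b + t\<^sup>2 * c" for t
  proof -
    have "0 \<le> M (\<lambda>x. (f x + t * g x)\<^sup>2)"
      by (intro nonneg bdd_fn_intros f g) simp
    also have "(\<lambda>x. (f x + t * g x)\<^sup>2)
        = (\<lambda>x. ((f x)\<^sup>2 + (2 * t) * (f x * g x)) + t\<^sup>2 * (g x)\<^sup>2)"
      by (auto simp: power2_eq_square algebra_simps)
    also have "M \<dots> = a + 2 * t * b + t\<^sup>2 * c"
      unfolding a_def b_def c_def by (simp add: add scale bdd_fn_intros f g)
    finally show ?thesis .
  qed
  have c0: "0 \<le> c" unfolding c_def by (intro nonneg bdd_fn_intros g) simp
  have "b\<^sup>2 \<le> a * c"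
  proof (cases "c = 0")
    case True
    have "b = 0"
    proof (rule ccontr)
      assume "b \<noteq> 0"
      \<comment> \<open>At this point the linear function \<open>a + 2 * t * b\<close> takes the value \<open>-1\<close>.\<close>
      then show False using q[of "- (a + 1) / (2 * b)"] True by (simp add: field_simps)
    qed
    then show ?thesis using True by simp
  next
    case False
    \<comment> \<open>The minimum of the quadratic function.\<close>
    then show ?thesis using q[of "- b / c"] c0
      by (simp add: field_simps power2_eq_square)
  qed
  then show ?thesis by (simp add: a_def b_def c_def)
qed

lemma square_le: "bdd_fn f \<Longrightarrow> (M f)\<^sup>2 \<le> M (\<lambda>x. (f x)\<^sup>2)"
  using Cauchy_Schwarz[OF _ bdd_fn_const[of 1], of f] by (simp add: one)

lemma correlation_le:
  assumes f: "\<And>x. \<bar>f x\<bar> \<le> 1" and g: "bdd_fn g" and "M (\<lambda>x. (g x)\<^sup>2) \<le> e\<^sup>2" and "0 \<le> e"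
  shows "\<bar>M (\<lambda>x. f x * g x)\<bar> \<le> e"
proof -
  have fb: "bdd_fn f" using f by (rule bdd_fnI)
  have "\<bar>(f x)\<^sup>2\<bar> \<le> 1" for x using f[of x] by (simp add: abs_square_le_1)
  then have "M (\<lambda>x. (f x)\<^sup>2) \<le> 1" using abs_le[of "\<lambda>x. (f x)\<^sup>2" 1] by (simp add: abs_le_iff)
  moreover have "0 \<le> M (\<lambda>x. (g x)\<^sup>2)" by (intro nonneg bdd_fn_intros g) simp
  ultimately have "(M (\<lambda>x. f x * g x))\<^sup>2 \<le> 1 * e\<^sup>2"
    using Cauchy_Schwarz[OF fb g] assms(3) mult_mono[of "M (\<lambda>x. (f x)\<^sup>2)" 1 "M (\<lambda>x. (g x)\<^sup>2)" "e\<^sup>2"] 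
    by simp
  then show ?thesis using \<open>0 \<le> e\<close> abs_le_square_iff[of _ e] by simp
qed

end

definition preserves :: "(('x \<Rightarrow> real) \<Rightarrow> real) \<Rightarrow> ('x \<Rightarrow> 'x) \<Rightarrow> bool" where
  "preserves M t \<longleftrightarrow> (\<forall>f. bdd_fn f \<longrightarrow> M (\<lambda>x. f (t x)) = M f)"

lemma preservesD: "preserves M t \<Longrightarrow> bdd_fn f \<Longrightarrow> M (\<lambda>x. f (t x)) = M f"
  by (simp add: preserves_def)

section \<open>Averages of translates\<close>

text \<open>Halvings are averages of translates of \<open>f\<close>. They stand in for the orthogonal projection of \<open>f\<close>
  onto the functions invariant under \<open>T\<close>, which need not exist, as the functions considered here
  do not form a complete space. Averaging two translates at a time generates enough averages, and
  makes every property of averages provable by a rule induction with one step.\<close>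

inductive_set halvings :: "('x \<Rightarrow> 'x) set \<Rightarrow> ('x \<Rightarrow> real) \<Rightarrow> ('x \<Rightarrow> real) set"
  for T f where
  base: "f \<in> halvings T f"
| half: "g \<in> halvings T f \<Longrightarrow> t \<in> T \<Longrightarrow> (\<lambda>v. (g v + g (t v)) / 2) \<in> halvings T f"

lemma halvings_abs_le:
  assumes "g \<in> halvings T f" and "\<And>x. \<bar>f x\<bar> \<le> B"
  shows "\<bar>g x\<bar> \<le> B"
  using assms(1)
proof (induction arbitrary: x)
  case base
  then show ?case using assms(2) .
next
  case (half g t)
  from half.IH[of x] half.IH[of "t x"] show ?case by (simp add: abs_le_iff)
qed

lemma halvings_bdd: "g \<in> halvings T f \<Longrightarrow> bdd_fn f \<Longrightarrow> bdd_fn g"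
  by (elim bdd_fnE) (rule bdd_fnI, rule halvings_abs_le)

context mean
begin

lemma halvings_mean:
  assumes "g \<in> halvings T f" and f: "bdd_fn f" and T: "\<And>t. t \<in> T \<Longrightarrow> preserves M t"
  shows "M g = M f"
  using assms(1)
proof (induction)
  case base
  then show ?case ..
next
  case (half g t)
  have g: "bdd_fn g" using half.hyps(1) f by (rule halvings_bdd)
  have "M (\<lambda>v. (1/2) * (g v + g (t v))) = (1/2) * (M g + M g)"
    by (simp only: scale add bdd_fn_intros g bdd_fn_comp[OF g] preservesD[OF T[OF half.hyps(2)] g])
  then show ?case using half.IH by simp
qed

text \<open>The mean ergodic theorem without completeness. If the mean square of \<open>g\<close> is within \<open>e / 4\<close> of the
  infimum over all halvings, then the midpoint of \<open>g\<close> and a translate cannot have a much smaller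
  mean square, so by the parallelogram law the two are close. The bound does not depend on the
  translation; this uniformity is what permits translations that vary with a parameter later.\<close>

lemma almost_invariant_halving:
  assumes f: "bdd_fn f" and T: "\<And>t. t \<in> T \<Longrightarrow> preserves M t" and "0 < e"
  obtains g where "g \<in> halvings T f" and "\<And>t. t \<in> T \<Longrightarrow> M (\<lambda>v. (g (t v) - g v)\<^sup>2) \<le> e"
proof -
  define A where "A = (\<lambda>g. M (\<lambda>v. (g v)\<^sup>2)) ` halvings T f"
  have bd: "bdd_fn g" if "g \<in> halvings T f" for g using halvings_bdd[OF that f] .
  have ne: "A \<noteq> {}" using halvings.base[of f T] by (auto simp: A_def)
  have "bdd_below A" unfolding A_def
    by (rule bdd_belowI[of _ 0]) (auto intro!: nonneg bdd_fn_power[OF bd])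
  then have low: "Inf A \<le> M (\<lambda>v. (g v)\<^sup>2)" if "g \<in> halvings T f" for g
    using that by (auto simp: A_def intro: cInf_lower)
  have "Inf A < Inf A + e / 4" using \<open>0 < e\<close> by simp
  then obtain y where "y \<in> A" "y < Inf A + e / 4" using cInf_lessD[OF ne] by blast
  then obtain g where g: "g \<in> halvings T f" "M (\<lambda>v. (g v)\<^sup>2) < Inf A + e / 4"
    by (auto simp: A_def)
  have "M (\<lambda>v. (g (t v) - g v)\<^sup>2) \<le> e" if t: "t \<in> T" for t
  proof -
    note b = bd[OF g(1)]
    let ?h = "\<lambda>v. (g v + g (t v)) / 2"
    have eq: "(\<lambda>v. (g (t v) - g v)\<^sup>2)
      = (\<lambda>v. (2 * (g v)\<^sup>2 + 2 * (g (t v))\<^sup>2) - 4 * (?h v)\<^sup>2)"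
      by (auto simp: power2_eq_square field_simps)
    have "M (\<lambda>v. (g (t v) - g v)\<^sup>2) 
        = 2 * M (\<lambda>v. (g v)\<^sup>2) + 2 * M (\<lambda>v. (g (t v))\<^sup>2) - 4 * M (\<lambda>v. (?h v)\<^sup>2)"
      unfolding eq by (simp only: diff add scale bdd_fn_intros b bdd_fn_comp[OF b])
    moreover have "M (\<lambda>v. (g (t v))\<^sup>2) = M (\<lambda>v. (g v)\<^sup>2)"
      using preservesD[OF T[OF t] bdd_fn_power[OF b]] .
    ultimately show ?thesis using g(2) low[OF halvings.half[OF g(1) t]] by linarith
  qed
  with g(1) show thesis by (rule that)
qed

text \<open>Against an almost invariant function all averages of translates of \<open>f\<close> look like \<open>f\<close>, since a
  translation can be moved to the other factor. Stating the bound for the translates \<open>g \<circ> t\<close> of a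
  halving keeps the error from growing with the number of halvings.\<close>

lemma halvings_correlation:
  assumes "g \<in> halvings T f" and f: "\<And>x. \<bar>f x\<bar> \<le> 1" and h: "bdd_fn h" and "0 \<le> e"
    and T: "\<And>t. t \<in> T \<Longrightarrow> preserves M t"
    and comp: "\<And>s t. s \<in> T \<Longrightarrow> t \<in> T \<Longrightarrow> (\<lambda>v. s (t v)) \<in> T"
    and h_inv: "\<And>t. t \<in> T \<Longrightarrow> M (\<lambda>v. (h (t v) - h v)\<^sup>2) \<le> e\<^sup>2"
    and "t \<in> T"
  shows "\<bar>M (\<lambda>v. g (t v) * h v) - M (\<lambda>v. f v * h v)\<bar> \<le> e"
  using assms(1) \<open>t \<in> T\<close>
proof (induction arbitrary: t)
  case base
  have fb: "bdd_fn f" using f by (rule bdd_fnI)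
  have "M (\<lambda>v. f v * h v) = M (\<lambda>v. f (t v) * h (t v))"
    using preservesD[OF T[OF base] bdd_fn_mult[OF fb h]] by simp
  then have "M (\<lambda>v. f v * h v) - M (\<lambda>v. f (t v) * h v) = M (\<lambda>v. f (t v) * (h (t v) - h v))"
    by (simp add: diff[symmetric] bdd_fn_intros h bdd_fn_comp[OF h] bdd_fn_comp[OF fb] right_diff_distrib)
  moreover have "\<bar>M (\<lambda>v. f (t v) * (h (t v) - h v))\<bar> \<le> e"
    by (rule correlation_le) (auto intro!: f h_inv base bdd_fn_intros h bdd_fn_comp[OF h] \<open>0 \<le> e\<close>)
  ultimately show ?case by linarith
next
  case (half g s)
  have fb: "bdd_fn f" using f by (rule bdd_fnI)
  have g: "bdd_fn g" using half.hyps(1) fb by (rule halvings_bdd)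
  have eq: "(\<lambda>v. (g (t v) + g (s (t v))) / 2 * h v)
     = (\<lambda>v. (1/2) * (g (t v) * h v + g (s (t v)) * h v))" by (auto simp: algebra_simps)
  have "M (\<lambda>v. (g (t v) + g (s (t v))) / 2 * h v) 
      = (1/2) * (M (\<lambda>v. g (t v) * h v) + M (\<lambda>v. g (s (t v)) * h v))"
    unfolding eq by (simp only: add scale bdd_fn_intros h bdd_fn_comp[OF g])
  moreover have "\<bar>M (\<lambda>v. g (t v) * h v) - M (\<lambda>v. f v * h v)\<bar> \<le> e"
    using half.IH[OF half.prems] .
  moreover have "\<bar>M (\<lambda>v. g (s (t v)) * h v) - M (\<lambda>v. f v * h v)\<bar> \<le> e"
    using half.IH[OF comp[OF half.hyps(2) half.prems]] by simp
  ultimately show ?case unfolding abs_le_iff by (simp add: field_simps)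
qed

end

lemma bdd_fn_slice_mean:
  assumes "mean L" and f: "bdd_fn f"
  shows "bdd_fn (\<lambda>u. L (\<lambda>v. f (u, v)))"
proof -
  from f obtain B where "\<And>z. \<bar>f z\<bar> \<le> B" by (auto simp: bdd_fn_def)
  then show ?thesis by (intro bdd_fnI[of _ B] mean.abs_le[OF \<open>mean L\<close>])
qed

lemma mean_product:
  assumes m: "mean m" and L: "mean L"
  shows "mean (\<lambda>f. m (\<lambda>u. L (\<lambda>v. f (u, v))))"
proof -
  interpret m: mean m by fact
  interpret L: mean L by fact
  note bs = bdd_fn_slice_mean[OF L]
  show ?thesis
  proof
    fix f g :: "'a \<times> 'b \<Rightarrow> real" and c
    assume f: "bdd_fn f" 
    show "m (\<lambda>u. L (\<lambda>v. c * f (u, v))) = c * m (\<lambda>u. L (\<lambda>v. f (u, v)))"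
      by (simp add: L.scale m.scale bs f bdd_fn_comp[OF f])
    show "0 \<le> m (\<lambda>u. L (\<lambda>v. f (u, v)))" if "\<And>z. 0 \<le> f z"
      by (intro m.nonneg L.nonneg bs f bdd_fn_comp[OF f] that)
    assume g: "bdd_fn g"
    show "m (\<lambda>u. L (\<lambda>v. f (u, v) + g (u, v))) 
        = m (\<lambda>u. L (\<lambda>v. f (u, v))) + m (\<lambda>u. L (\<lambda>v. g (u, v)))"
      by (simp add: L.add m.add bs f g bdd_fn_comp[OF f] bdd_fn_comp[OF g])
  qed (simp add: L.one m.one)
qed

section \<open>Differences of polynomials\<close>

lemma poly_coeff_pcompose_linear_shift:
  fixes q :: "'a::comm_ring_1 poly"
  shows "coeff (pcompose q [:h, 1:]) k
      = (\<Sum>i\<le>degree q. coeff q i * (of_nat (i choose k) * h ^ (i - k)))"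
proof -
  have pow: "pcompose (p ^ n) r = pcompose p r ^ n" for p r :: "'a poly" and n
    by (induction n) (simp_all add: pcompose_mult pcompose_1)
  have "pcompose q [:h, 1:] = pcompose (\<Sum>i\<le>degree q. monom (coeff q i) i) [:h, 1:]"
    by (simp add: poly_as_sum_of_monoms)
  also have "\<dots> = (\<Sum>i\<le>degree q. smult (coeff q i) ([:h, 1:] ^ i))"
    by (simp add: pcompose_sum monom_altdef pcompose_smult pow pcompose_pCons)
  finally have eq: "pcompose q [:h, 1:] = (\<Sum>i\<le>degree q. smult (coeff q i) ([:h, 1:] ^ i))" .
  have "coeff ([:h, 1:] ^ i) k = of_nat (i choose k) * h ^ (i - k)" for i
  proof (cases "k \<le> i")
    case True
    then show ?thesis by (simp add: coeff_linear_poly_power)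
  next
    case False
    moreover have "degree ([:h, 1:] ^ i) \<le> i"
      using degree_power_le[of "[:h, 1:]" i] by simp
    ultimately show ?thesis by (simp add: coeff_eq_0 binomial_eq_0)
  qed
  then show ?thesis by (simp add: eq coeff_sum)
qed

text \<open>The coefficient of degree \<open>n\<close> of the difference is \<open>of_nat (Suc n) * h\<close> times the leading
  coefficient of \<open>q\<close>; in small positive characteristic it could vanish.\<close>

lemma degree_shift_difference:
  fixes q :: "'a::idom poly"
  assumes deg: "degree q = Suc n" and "of_nat (Suc n) \<noteq> (0::'a)" and "h \<noteq> 0"
  shows "degree (pcompose q [:h, 1:] - q) = n"
proof (rule antisym)
  let ?r = "pcompose q [:h, 1:] - q"
  have co: "coeff (pcompose q [:h, 1:]) k = coeff q k" if "k \<ge> Suc n" for k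
  proof (cases "k = Suc n")
    case True
    have "(\<Sum>i\<le>Suc n. coeff q i * (of_nat (i choose k) * h ^ (i - k))) = coeff q k"
      unfolding sum.atMost_Suc using True by (simp add: binomial_eq_0)
    then show ?thesis by (simp add: poly_coeff_pcompose_linear_shift deg)
  next
    case False
    then have "k > Suc n" using that by simp
    then have "(\<Sum>i\<le>Suc n. coeff q i * (of_nat (i choose k) * h ^ (i - k))) = 0"
      by (intro sum.neutral) (auto simp: binomial_eq_0)
    then show ?thesis using \<open>k > Suc n\<close> by (simp add: poly_coeff_pcompose_linear_shift deg coeff_eq_0)
  qed
  show "degree ?r \<le> n"
    by (rule degree_le) (auto simp: co)
  have "coeff (pcompose q [:h, 1:]) n = coeff q n + coeff q (Suc n) * (of_nat (Suc n) * h)"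
  proof (cases n)
    case 0
    then show ?thesis using deg by (simp add: poly_altdef)
  next
    case (Suc k)
    have "(\<Sum>i\<le>k. coeff q i * (of_nat (i choose n) * h ^ (i - n))) = 0"
      using Suc by (intro sum.neutral) (auto simp: binomial_eq_0)
    then show ?thesis using Suc
      by (simp add: poly_coeff_pcompose_linear_shift deg binomial_Suc_n)
  qed
  moreover have "coeff q (Suc n) \<noteq> 0" using deg by (metis leading_coeff_0_iff degree_0 nat.distinct(1))
  ultimately have "coeff ?r n \<noteq> 0" using assms(2,3) by simp
  then show "n \<le> degree ?r" by (rule le_degree)
qed

section \<open>Systems with an action of the affine group\<close>

text \<open>The base \<open>m\<close> averages over the parameter \<open>u\<close> of the pattern and the fibre \<open>L\<close> over a space on
  which the affine group acts, \<open>act a b\<close> being the action of the map sending \<open>x\<close> to \<open>a * x + b\<close>. The base is the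
  field with its own affine action; the fibre is left open so that it can be a power of the field
  with the diagonal action.\<close>
locale affine_system = base: mean m + fibre: mean L
  for m :: "('a::field \<Rightarrow> real) \<Rightarrow> real" and L :: "('x \<Rightarrow> real) \<Rightarrow> real" +
  fixes act :: "'a \<Rightarrow> 'a \<Rightarrow> 'x \<Rightarrow> 'x"
  assumes infinite_field: "infinite (UNIV :: 'a set)"
    and act_act: "act a b (act c d v) = act (a * c) (a * d + b) v"
    and act_id: "act 1 0 v = v"
    and act_preserves: "a \<noteq> 0 \<Longrightarrow> preserves L (act a b)"
    and affine_preserves: "a \<noteq> 0 \<Longrightarrow> preserves m (\<lambda>x. a * x + b)"
begin

definition joint :: "('a \<times> 'x \<Rightarrow> real) \<Rightarrow> real" where
  "joint f = m (\<lambda>u. L (\<lambda>v. f (u, v)))"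

sublocale joint: mean joint
  unfolding joint_def[abs_def] by (rule mean_product) unfold_locales

lemma scaling_preserves: "a \<noteq> 0 \<Longrightarrow> preserves m (\<lambda>x. a * x)"
  using affine_preserves[of a 0] by simp

lemma translation_preserves: "preserves m (\<lambda>x. x + b)"
  using affine_preserves[of 1 b] by simp

text \<open>Disjoint translates of a point all have the same mean, and infinitely many of them fit. Hence
  \<open>u = 0\<close>, for which multiplication by \<open>u\<close> is not invertible, can be ignored in what follows.\<close>

lemma mean_indicator_zero: "m (indicat_real {0}) = 0"
proof -
  define c where "c = m (indicat_real {0})"
  have c: "m (indicat_real {x}) = c" for x
  proof -
    have "(\<lambda>y. indicat_real {x} (y + x)) = indicat_real {0}"
      by (auto simp: indicator_def)
    then show ?thesis
      using preservesD[OF translation_preserves[of x] bdd_fn_indicator[of "{x}"]] by (simp add: c_def)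
  qed
  have "0 \<le> c" unfolding c_def by (intro base.nonneg bdd_fn_indicator) simp
  have "of_nat n * c \<le> 1" for n :: nat
  proof -
    obtain S :: "'a set" where S: "card S = n" "finite S"
      using infinite_arbitrarily_large[OF infinite_field] by blast
    have "of_nat n * c = (\<Sum>x\<in>S. m (indicat_real {x}))" using S c by simp
    also have "\<dots> = m (\<lambda>y. \<Sum>x\<in>S. indicat_real {x} y)"
      by (intro base.sum[symmetric] S bdd_fn_indicator)
    also have "\<dots> \<le> m (\<lambda>y. 1)"
    proof (rule base.mono)
      show "(\<Sum>x\<in>S. indicat_real {x} y) \<le> 1" for y
        using S by (simp add: indicator_def of_bool_def if_distrib cong: if_cong)
    qed (intro bdd_fn_const bdd_fn_sum bdd_fn_indicator)+
    finally show ?thesis by (simp add: base.one)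
  qed
  then have "\<not> 0 < c" using reals_Archimedean3[of c] by (meson not_le)
  with \<open>0 \<le> c\<close> show ?thesis by (simp add: c_def)
qed

lemma mean_mono_nonzero:
  assumes f: "bdd_fn f" and g: "bdd_fn g" and le: "\<And>u. u \<noteq> 0 \<Longrightarrow> f u \<le> g u"
  shows "m f \<le> m g"
proof -
  have "m f \<le> m (\<lambda>u. g u + \<bar>f 0 - g 0\<bar> * indicat_real {0} u)"
  proof (rule base.mono)
    fix u
    show "f u \<le> g u + \<bar>f 0 - g 0\<bar> * indicat_real {0} u"
      using le[of u] by (cases "u = 0") auto
  qed (intro bdd_fn_intros bdd_fn_indicator f g)+
  also have "\<dots> = m g"
    by (simp add: base.add base.scale bdd_fn_mult bdd_fn_const bdd_fn_indicator g mean_indicator_zero)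
  finally show ?thesis .
qed

lemma mean_cong_nonzero:
  assumes "bdd_fn f" and "bdd_fn g" and "\<And>u. u \<noteq> 0 \<Longrightarrow> f u = g u"
  shows "m f = m g"
  using assms by (intro antisym mean_mono_nonzero) auto

text \<open>For each fixed \<open>u\<close> the fibre variable may be replaced by an affine image depending on \<open>u\<close>. All
  changes of variables in the correlation computations below have this form.\<close>

lemma joint_fibre_change:
  assumes f: "bdd_fn f" and g: "bdd_fn g" and a: "\<And>u. u \<noteq> 0 \<Longrightarrow> a u \<noteq> 0"
    and eq: "\<And>u v. u \<noteq> 0 \<Longrightarrow> g (u, v) = f (u, act (a u) (b u) v)"
  shows "joint g = joint f"
  unfolding joint_def
proof (rule mean_cong_nonzero)
  fix u :: 'a assume u: "u \<noteq> 0"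
  have "L (\<lambda>v. g (u, v)) = L (\<lambda>v. f (u, act (a u) (b u) v))" using u by (simp add: eq)
  also have "\<dots> = L (\<lambda>v. f (u, v))"
    using preservesD[OF act_preserves[OF a[OF u]] bdd_fn_comp[OF f]] .
  finally show "L (\<lambda>v. g (u, v)) = L (\<lambda>v. f (u, v))" .
qed (intro bdd_fn_slice_mean f g fibre.mean_axioms)+

lemma joint_base_change:
  assumes "preserves m s" and f: "bdd_fn f"
  shows "joint (\<lambda>z. f (s (fst z), snd z)) = joint f"
  unfolding joint_def 
  using preservesD[OF assms(1) bdd_fn_slice_mean[OF fibre.mean_axioms f]] by simp



section \<open>Polynomial correlations vanish on coboundaries\<close>

text \<open>The van der Corput trick. The correlation of \<open>h\<close> with \<open>a\<close> does not change when \<open>a\<close> is replaced by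
  its average over \<open>n\<close> reparametrisations of the base. If these are pairwise orthogonal, the average
  has mean square at most a constant over \<open>n\<close>, so Cauchy-Schwarz forces the correlation to vanish
  as \<open>n\<close> grows. The reparametrisations will be translations in one use and dilations in another.\<close>

lemma van_der_Corput:
  fixes s :: "'i \<Rightarrow> 'a \<Rightarrow> 'a"
  assumes a: "bdd_fn a" and h: "bdd_fn h"
    and large: "\<And>n. \<exists>S. finite S \<and> card S = n \<and> (\<forall>i\<in>S. preserves m (s i)) \<and>
      (\<forall>i\<in>S. \<forall>j\<in>S. i \<noteq> j \<longrightarrow>
        joint (\<lambda>z. a (s i (fst z), snd z) * a (s j (fst z), snd z)) = 0)"
  shows "joint (\<lambda>z. h (snd z) * a z) = 0"
proof -
  define I where "I = joint (\<lambda>z. h (snd z) * a z)"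
  define c where "c = joint (\<lambda>z. (h (snd z))\<^sup>2) * joint (\<lambda>z. (a z)\<^sup>2)"
  have bound: "real n * I\<^sup>2 \<le> c" if "0 < n" for n :: nat
  proof -
    from large[of n] obtain S where S: "finite S" "card S = n"
      and pres': "\<forall>i\<in>S. preserves m (s i)"
      and orth': "\<forall>i\<in>S. \<forall>j\<in>S. i \<noteq> j \<longrightarrow>
        joint (\<lambda>z. a (s i (fst z), snd z) * a (s j (fst z), snd z)) = 0"
      by (elim exE conjE)
    note pres = bspec[OF pres']
    note orth = mp[OF bspec[OF bspec[OF orth']]]
    define A where "A i z = a (s i (fst z), snd z)" for i z
    have A: "bdd_fn (A i)" for i unfolding A_def by (rule bdd_fn_comp[OF a])
    note b = A bdd_fn_comp[OF h] bdd_fn_mult bdd_fn_sum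
    have "joint (\<lambda>z. h (snd z) * A i z) = I" if "i \<in> S" for i
      using joint_base_change[OF pres[OF that] bdd_fn_mult[OF bdd_fn_comp[OF h, of snd] a]]
      by (simp add: A_def I_def)
    then have "real n * I = (\<Sum>i\<in>S. joint (\<lambda>z. h (snd z) * A i z))" using S by simp
    also have "\<dots> = joint (\<lambda>z. \<Sum>i\<in>S. h (snd z) * A i z)"
      by (intro joint.sum[symmetric] S b)
    also have "\<dots> = joint (\<lambda>z. h (snd z) * (\<Sum>i\<in>S. A i z))"
      by (simp add: sum_distrib_left)
    finally have I: "real n * I = joint (\<lambda>z. h (snd z) * (\<Sum>i\<in>S. A i z))" .
    have CS: "(real n * I)\<^sup>2 \<le> joint (\<lambda>z. (h (snd z))\<^sup>2) * joint (\<lambda>z. (\<Sum>i\<in>S. A i z)\<^sup>2)"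
      unfolding I by (intro joint.Cauchy_Schwarz b)
    have "joint (\<lambda>z. (\<Sum>i\<in>S. A i z)\<^sup>2) = joint (\<lambda>z. \<Sum>i\<in>S. \<Sum>j\<in>S. A i z * A j z)"
      by (simp add: power2_eq_square sum_product)
    also have "\<dots> = (\<Sum>i\<in>S. joint (\<lambda>z. \<Sum>j\<in>S. A i z * A j z))"
      by (intro joint.sum S b)
    also have "\<dots> = (\<Sum>i\<in>S. \<Sum>j\<in>S. joint (\<lambda>z. A i z * A j z))"
      by (intro sum.cong refl joint.sum S b)
    also have "\<dots> = (\<Sum>i\<in>S. \<Sum>j\<in>S. if i = j then joint (\<lambda>z. (a z)\<^sup>2) else 0)"
    proof (intro sum.cong refl)
      fix i j assume ij: "i \<in> S" "j \<in> S"
      show "joint (\<lambda>z. A i z * A j z) = (if i = j then joint (\<lambda>z. (a z)\<^sup>2) else 0)"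
        using orth[OF ij] joint_base_change[OF pres[OF ij(1)] bdd_fn_power[OF a, of 2]]
        by (auto simp: A_def power2_eq_square)
    qed
    also have "\<dots> = real n * joint (\<lambda>z. (a z)\<^sup>2)" using S by simp
    finally have "joint (\<lambda>z. (\<Sum>i\<in>S. A i z)\<^sup>2) = real n * joint (\<lambda>z. (a z)\<^sup>2)" .
    with CS have "real n * (real n * I\<^sup>2) \<le> real n * c"
      by (simp add: c_def power_mult_distrib power2_eq_square[of "real n"] mult_ac)
    then show ?thesis using \<open>0 < n\<close> by simp
  qed
  have "\<not> 0 < I\<^sup>2"
  proof
    assume "0 < I\<^sup>2"
    then obtain n :: nat where n: "c < real n * I\<^sup>2" using reals_Archimedean3 by blast
    moreover have "real n * I\<^sup>2 \<le> real (Suc n) * I\<^sup>2" by (intro mult_right_mono) auto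
    ultimately show False using bound[of "Suc n"] by linarith
  qed
  then show ?thesis by (simp add: I_def)
qed


text \<open>For linear \<open>q\<close> the shift by \<open>y\<close> hidden in \<open>F\<close> is a translation of the parameter \<open>u\<close>, which \<open>m\<close>
  does not see. In higher degree, correlating two translates of the parameter leaves the
  difference polynomial in place of \<open>q\<close>, which has smaller degree, and van der Corput applies.\<close>

lemma polynomial_shift_annihilates:
  assumes f: "bdd_fn f" and F: "\<And>v. F v = f v - f (act 1 y v)"
    and "degree q = Suc n" and "\<And>k. 0 < k \<Longrightarrow> k \<le> Suc n \<Longrightarrow> of_nat k \<noteq> (0::'a)"
    and "bdd_fn h"
  shows "joint (\<lambda>z. h (snd z) * F (act 1 (poly q (fst z)) (snd z))) = 0"
  using assms(3-)
proof (induction n arbitrary: q h)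
  case 0
  note h = bdd_fn_comp[OF \<open>bdd_fn h\<close>] and f' = bdd_fn_comp[OF f]
  obtain e r where r: "q = pCons e r" by (cases q)
  with \<open>degree q = Suc 0\<close> have "degree r = 0" "r \<noteq> 0" by (auto split: if_splits)
  then obtain c where q: "q = [:e, c:]" and "c \<noteq> 0"
    using r by (auto elim!: degree_eq_zeroE)
  let ?g = "\<lambda>z. h (snd z) * f (act 1 (poly q (fst z)) (snd z))"
  have "joint (\<lambda>z. h (snd z) * F (act 1 (poly q (fst z)) (snd z)))
      = joint (\<lambda>z. ?g z - ?g (fst z + y / c, snd z))"
    using \<open>c \<noteq> 0\<close> by (simp add: F act_act q right_diff_distrib algebra_simps)
  also have "\<dots> = joint ?g - joint (\<lambda>z. ?g (fst z + y / c, snd z))"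
    by (intro joint.diff bdd_fn_mult h f')
  also have "joint (\<lambda>z. ?g (fst z + y / c, snd z)) = joint ?g"
    by (intro joint_base_change[OF translation_preserves] bdd_fn_mult h f')
  finally show ?case by simp
next
  case (Suc n)
  have Fb: "bdd_fn F" unfolding F[abs_def] by (intro bdd_fn_diff f bdd_fn_comp[OF f])
  define a where "a z = F (act 1 (poly q (fst z)) (snd z))" for z
  have a: "bdd_fn a" unfolding a_def[abs_def] by (rule bdd_fn_comp[OF Fb])
  have orth: "joint (\<lambda>z. a (fst z + i, snd z) * a (fst z + j, snd z)) = 0" if "i \<noteq> j" for i j
  proof -
    \<comment> \<open>Translating the base by \<open>j\<close> turns the difference of the shifts by \<open>i\<close> and \<open>j\<close> into a plain difference.\<close>
    define r where "r = pcompose q [:i - j, 1:] - q"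
    have r: "degree r = Suc n" unfolding r_def
      using that by (intro degree_shift_difference Suc.prems) auto
    have r_eq: "poly r (u + j) = poly q (u + i) - poly q (u + j)" for u
      by (simp add: r_def poly_pcompose algebra_simps)
    define g where "g z = F (snd z) * F (act 1 (poly r (fst z)) (snd z))" for z
    have g: "bdd_fn g" unfolding g_def[abs_def] by (intro bdd_fn_mult bdd_fn_comp[OF Fb])
    have "joint (\<lambda>z. a (fst z + i, snd z) * a (fst z + j, snd z))
        = joint (\<lambda>z. g (fst z + j, snd z))"
      by (rule joint_fibre_change[where a = "\<lambda>u. 1" and b = "\<lambda>u. poly q (u + j)"])
        (auto intro!: bdd_fn_mult bdd_fn_comp[OF Fb]
          simp: a_def g_def act_act r_eq mult.commute)
    also have "\<dots> = joint g" by (rule joint_base_change[OF translation_preserves g])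
    also have "\<dots> = 0" unfolding g_def[abs_def]
      using Suc.prems by (intro Suc.IH r Fb) auto
    finally show ?thesis .
  qed
  have "joint (\<lambda>z. h (snd z) * a z) = 0"
  proof (rule van_der_Corput[OF a \<open>bdd_fn h\<close>, where s = "\<lambda>i u. u + i"])
    fix k
    obtain S :: "'a set" where "finite S" "card S = k"
      using infinite_arbitrarily_large[OF infinite_field] by blast
    then show "\<exists>S. finite S \<and> card S = k \<and> (\<forall>i\<in>S. preserves m (\<lambda>u. u + i)) \<and>
      (\<forall>i\<in>S. \<forall>j\<in>S. i \<noteq> j \<longrightarrow> joint (\<lambda>z. a (fst z + i, snd z) * a (fst z + j, snd z)) = 0)"
      using orth translation_preserves by (intro exI[of _ S]) auto
  qed
  then show ?case by (simp add: a_def)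
qed

text \<open>Provides arbitrarily many dilations with pairwise distinct powers: each power is attained finitely
  often only, as the roots of a nonzero polynomial.\<close>

lemma infinite_power_image: "infinite ((\<lambda>x::'a. x ^ Suc d) ` (- {0}))"
proof
  assume fin: "finite ((\<lambda>x::'a. x ^ Suc d) ` (- {0}))"
  have "infinite (- {0::'a})" using infinite_field by (simp add: Compl_eq_Diff_UNIV)
  then obtain a where "a \<in> - {0::'a}" "infinite {x \<in> - {0}. x ^ Suc d = a ^ Suc d}"
    using pigeonhole_infinite[OF _ fin] by blast
  moreover have "finite {x. poly (monom 1 (Suc d) - [:a ^ Suc d:]) x = 0}"
  proof (rule poly_roots_finite)
    have "coeff (monom 1 (Suc d) - [:a ^ Suc d:]) (Suc d) = (1::'a)" by simp
    then show "monom 1 (Suc d) - [:a ^ Suc d:] \<noteq> 0" by (metis coeff_0 zero_neq_one)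
  qed
  then have "finite {x \<in> - {0}. x ^ Suc d = a ^ Suc d}"
    by (rule finite_subset[rotated]) (auto simp: poly_monom)
  ultimately show False by blast
qed

text \<open>After the fibre is rescaled by \<open>u\<close>, the second factor is \<open>F\<close> at the point \<open>v / u + p(u)\<close>. Replacing
  \<open>u\<close> by \<open>i * u\<close> and by \<open>j * u\<close> and correlating the results, a change of variables leaves
  the shift by \<open>(i / j) * p(i * u) - p(j * u)\<close>. This polynomial has the degree of \<open>p\<close> unless
  \<open>i ^ (degree p + 1) = j ^ (degree p + 1)\<close>, so the previous lemma makes these correlations vanish.
  Dilations of \<open>u\<close> are used because they keep the ratio of the two rescalings independent of \<open>u\<close>;
  translations would not.\<close>

lemma twisted_shift_annihilates:
  assumes f: "bdd_fn f" and F: "\<And>v. F v = f v - f (act 1 y v)"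
    and deg: "degree p = Suc n" and char: "\<And>k. 0 < k \<Longrightarrow> k \<le> Suc n \<Longrightarrow> of_nat k \<noteq> (0::'a)"
    and h: "bdd_fn h"
  shows "joint (\<lambda>z. h (act (fst z) 0 (snd z)) * F (act 1 (poly p (fst z)) (snd z))) = 0"
proof -
  have Fb: "bdd_fn F" unfolding F[abs_def] by (intro bdd_fn_diff f bdd_fn_comp[OF f])
  define a where "a z = F (act (1 / fst z) (poly p (fst z)) (snd z))" for z
  have a: "bdd_fn a" unfolding a_def[abs_def] by (rule bdd_fn_comp[OF Fb])
  have orth: "joint (\<lambda>z. a (i * fst z, snd z) * a (j * fst z, snd z)) = 0"
    if "i \<noteq> 0" "j \<noteq> 0" and ij: "i ^ Suc (Suc n) \<noteq> j ^ Suc (Suc n)" for i j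
  proof -
    define c where "c = j / i"
    have "c \<noteq> 0" using that by (simp add: c_def)
    define r where "r = smult (i / j) (pcompose p [:0, i:]) - pcompose p [:0, j:]"
    have r_eq: "c * poly r u = poly p (i * u) - c * poly p (j * u)" for u
      using that by (simp add: r_def c_def poly_pcompose algebra_simps)
    have "degree r = Suc n"
    proof (rule antisym)
      show "degree r \<le> Suc n" unfolding r_def
        by (intro degree_diff_le order.trans[OF degree_smult_le] order.trans[OF degree_pcompose_le])
          (auto simp: deg)
      have "j * coeff r (Suc n) = (i ^ Suc (Suc n) - j ^ Suc (Suc n)) * coeff p (Suc n)"
        using that(2) by (simp add: r_def coeff_pcompose_linear algebra_simps)
      moreover have "coeff p (Suc n) \<noteq> 0"
        using deg by (metis leading_coeff_0_iff degree_0 nat.distinct(1))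
      ultimately have "coeff r (Suc n) \<noteq> 0" using ij by auto
      then show "Suc n \<le> degree r" by (rule le_degree)
    qed
    \<comment> \<open>The remaining dilation by \<open>c\<close> goes into \<open>F\<close>, which stays a coboundary.\<close>
    define G where "G v = F (act c 0 v)" for v
    have G: "bdd_fn G" unfolding G_def[abs_def] by (rule bdd_fn_comp[OF Fb])
    have "joint (\<lambda>z. a (i * fst z, snd z) * a (j * fst z, snd z))
        = joint (\<lambda>z. F (snd z) * G (act 1 (poly r (fst z)) (snd z)))"
      by (rule joint_fibre_change[where a = "\<lambda>u. 1 / (j * u)" and b = "\<lambda>u. poly p (j * u)"])
        (use that in \<open>auto intro!: bdd_fn_mult bdd_fn_comp[OF a] bdd_fn_comp[OF Fb] bdd_fn_comp[OF G]
          simp: a_def G_def act_act ring_distribs r_eq\<close>, simp add: c_def)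
    also have "\<dots> = 0"
    proof (rule polynomial_shift_annihilates[where f = "\<lambda>v. f (act c 0 v)" and y = "y / c"])
      show "G v = f (act c 0 v) - f (act c 0 (act 1 (y / c) v))" for v
        using \<open>c \<noteq> 0\<close> by (simp add: G_def F act_act)
    qed (use \<open>degree r = Suc n\<close> char in \<open>auto intro: bdd_fn_comp[OF f] Fb\<close>)
    finally show ?thesis .
  qed
  have "joint (\<lambda>z. h (act (fst z) 0 (snd z)) * F (act 1 (poly p (fst z)) (snd z)))
      = joint (\<lambda>z. h (snd z) * a z)"
    by (rule joint_fibre_change[where a = "\<lambda>u. u" and b = "\<lambda>u. 0"])
      (auto intro!: bdd_fn_mult bdd_fn_comp[OF a] bdd_fn_comp[OF Fb] bdd_fn_comp[OF h] a
          simp: a_def act_act)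
  also have "\<dots> = 0"
  proof (rule van_der_Corput[OF a h, where s = "\<lambda>i u. i * u"])
    fix k
    obtain P where P: "P \<subseteq> (\<lambda>x::'a. x ^ Suc (Suc n)) ` (- {0})" "finite P" "card P = k"
      using infinite_arbitrarily_large[OF infinite_power_image] by metis
    then obtain S where S: "S \<subseteq> - {0}" "inj_on (\<lambda>x::'a. x ^ Suc (Suc n)) S"
        "P = (\<lambda>x. x ^ Suc (Suc n)) ` S"
      by (auto simp only: subset_image_inj)
    have "finite S" "card S = k" using P S finite_imageD card_image by metis+
    moreover have "\<forall>i\<in>S. preserves m (\<lambda>u. i * u)" using S(1) by (intro ballI scaling_preserves) auto
    moreover have "\<forall>i\<in>S. \<forall>j\<in>S. i \<noteq> j \<longrightarrow>
        joint (\<lambda>z. a (i * fst z, snd z) * a (j * fst z, snd z)) = 0"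
      using S(1) inj_on_eq_iff[OF S(2)] by (intro ballI impI orth) blast+
    ultimately show "\<exists>S. finite S \<and> card S = k \<and> (\<forall>i\<in>S. preserves m (\<lambda>u. i * u)) \<and>
      (\<forall>i\<in>S. \<forall>j\<in>S. i \<noteq> j \<longrightarrow> joint (\<lambda>z. a (i * fst z, snd z) * a (j * fst z, snd z)) = 0)"
      by (intro exI[of _ S] conjI)
  qed
  finally show ?thesis .
qed


section \<open>Recurrence along affine maps\<close>

text \<open>Positive definiteness under dilations. As \<open>m\<close> is invariant under dilations, the factor
  \<open>g (act u 0 v)\<close> may be replaced by the same expression for an almost dilation invariant average \<open>k\<close>
  of \<open>g\<close>. Then \<open>u\<close> disappears up to a small error, what remains is close to the mean of
  \<open>k * k\<close>, and this is at least the square of the mean of \<open>k\<close>, which is the mean of \<open>g\<close>.\<close>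

lemma multiplicative_recurrence:
  assumes g1: "\<And>v. \<bar>g v\<bar> \<le> 1"
  shows "(L g)\<^sup>2 \<le> joint (\<lambda>z. g (act (fst z) 0 (snd z)) * g (snd z))"
proof (rule field_le_epsilon)
  fix e :: real assume "0 < e"
  then have e: "0 \<le> e / 2" by simp
  define T where "T = (\<lambda>a. act a 0) ` (- {0})"
  have T: "preserves L t" if "t \<in> T" for t using that act_preserves by (auto simp: T_def)
  have T_comp: "(\<lambda>v. s (t v)) \<in> T" if "s \<in> T" "t \<in> T" for s t
    using that by (auto simp: T_def act_act fun_eq_iff intro!: image_eqI[where f = "\<lambda>a. act a 0"])
  have id: "act 1 0 \<in> T" by (auto simp: T_def)
  have gb: "bdd_fn g" using g1 by (rule bdd_fnI)
  obtain k where k: "k \<in> halvings T g"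
    and k_inv: "\<And>t. t \<in> T \<Longrightarrow> L (\<lambda>v. (k (t v) - k v)\<^sup>2) \<le> (e / 2)\<^sup>2"
    using fibre.almost_invariant_halving[OF gb T, where e = "(e / 2)\<^sup>2"] \<open>0 < e\<close> by auto
  have kb: "bdd_fn k" using halvings_bdd[OF k gb] .
  define J where "J f = joint (\<lambda>z. f (act (fst z) 0 (snd z)) * g (snd z))" for f
  have J_halving: "J f = J g" if "f \<in> halvings T g" for f
    using that
  proof induction
    case (half f t)
    have fb: "bdd_fn f" using halvings_bdd[OF half.hyps(1) gb] .
    note b = bdd_fn_mult bdd_fn_comp[OF fb] bdd_fn_comp[OF gb]
    obtain a where a: "a \<noteq> 0" "t = act a 0" using half.hyps(2) by (auto simp: T_def)
    let ?h = "\<lambda>z. f (act (fst z) 0 (snd z)) * g (snd z)"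
    have "J (\<lambda>v. (f v + f (t v)) / 2) = joint (\<lambda>z. (1/2) * (?h z + ?h (a * fst z, snd z)))"
      by (simp add: J_def a act_act algebra_simps add_divide_distrib)
    also have "\<dots> = (1/2) * (joint ?h + joint (\<lambda>z. ?h (a * fst z, snd z)))"
      by (simp only: joint.scale joint.add bdd_fn_add b)
    also have "joint (\<lambda>z. ?h (a * fst z, snd z)) = joint ?h"
      by (intro joint_base_change scaling_preserves a b)
    finally show ?case using half.IH by (simp add: J_def)
  qed simp
  have "L (\<lambda>v. k v * g v) - e / 2 \<le> L (\<lambda>v. k (act u 0 v) * g v)" if "u \<noteq> 0" for u
  proof -
    have "act u 0 \<in> T" using that by (auto simp: T_def)
    note b = bdd_fn_mult bdd_fn_diff bdd_fn_comp[OF kb] bdd_fn_comp[OF gb]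
    have "\<bar>L (\<lambda>v. g v * (k (act u 0 v) - k v))\<bar> \<le> e / 2"
      using k_inv[OF \<open>act u 0 \<in> T\<close>] \<open>0 < e\<close> by (intro fibre.correlation_le g1 b kb) auto
    moreover have "L (\<lambda>v. g v * (k (act u 0 v) - k v))
        = L (\<lambda>v. k (act u 0 v) * g v) - L (\<lambda>v. k v * g v)"
      by (simp add: fibre.diff[symmetric] b kb gb algebra_simps)
    ultimately show ?thesis by linarith
  qed
  then have "m (\<lambda>u. L (\<lambda>v. k v * g v) - e / 2) \<le> J k"
    unfolding J_def joint_def using \<open>0 < e\<close>
    by (intro mean_mono_nonzero bdd_fn_const bdd_fn_slice_mean fibre.mean_axioms bdd_fn_mult
        bdd_fn_comp[OF kb] bdd_fn_comp[OF gb]) auto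
  then have "L (\<lambda>v. k v * g v) - e / 2 \<le> J g" by (simp add: base.const J_halving[OF k])
  moreover have "\<bar>L (\<lambda>v. k (act 1 0 v) * k v) - L (\<lambda>v. g v * k v)\<bar> \<le> e / 2"
    by (rule fibre.halvings_correlation[OF k g1 kb, where t = "act 1 0"])
      (fact e T T_comp k_inv id)+
  moreover have "(L g)\<^sup>2 \<le> L (\<lambda>v. k v * k v)"
    using fibre.square_le[OF kb] fibre.halvings_mean[OF k gb T] by (simp add: power2_eq_square)
  ultimately show "(L g)\<^sup>2 \<le> joint (\<lambda>z. g (act (fst z) 0 (snd z)) * g (snd z)) + e"
    unfolding abs_diff_le_iff by (simp add: act_id J_def mult.commute)
qed

text \<open>Since coboundaries do not contribute, \<open>f\<close> may be replaced in the second factor by an almost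
  translation invariant average \<open>g\<close>. By uniformity the translation by \<open>p(u)\<close> can then be dropped for
  all \<open>u\<close> at once. Next, \<open>g\<close> rescaled by \<open>1 / u\<close> is as translation invariant as \<open>g\<close> itself, so \<open>f\<close>
  becomes \<open>g\<close> in the first factor too, and only dilations are left.\<close>

theorem affine_recurrence:
  assumes f1: "\<And>v. \<bar>f v\<bar> \<le> 1"
    and deg: "degree p = Suc n" and char: "\<And>k. 0 < k \<Longrightarrow> k \<le> Suc n \<Longrightarrow> of_nat k \<noteq> (0::'a)"
  shows "(L f)\<^sup>2 \<le> joint (\<lambda>z. f (act (fst z) 0 (snd z)) * f (act 1 (poly p (fst z)) (snd z)))"
proof (rule field_le_epsilon)
  fix e :: real assume "0 < e"
  then have e: "0 \<le> e / 2" by simp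
  define T where "T = range (act 1)"
  have T: "preserves L t" if "t \<in> T" for t using that act_preserves[of 1] by (auto simp: T_def)
  have T_comp: "(\<lambda>v. s (t v)) \<in> T" if "s \<in> T" "t \<in> T" for s t
    using that by (auto simp: T_def act_act fun_eq_iff intro!: image_eqI[where f = "act 1"])
  have id: "act 1 0 \<in> T" by (auto simp: T_def)
  have fb: "bdd_fn f" using f1 by (rule bdd_fnI)
  obtain g where g: "g \<in> halvings T f"
    and g_inv: "\<And>t. t \<in> T \<Longrightarrow> L (\<lambda>v. (g (t v) - g v)\<^sup>2) \<le> (e / 2)\<^sup>2"
    using fibre.almost_invariant_halving[OF fb T, where e = "(e / 2)\<^sup>2"] \<open>0 < e\<close> by auto
  have gb: "bdd_fn g" using halvings_bdd[OF g fb] .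
  have g1: "\<bar>g v\<bar> \<le> 1" for v using halvings_abs_le[OF g f1] .
  note b = bdd_fn_mult bdd_fn_diff bdd_fn_comp[OF fb] bdd_fn_comp[OF gb]
  define J where "J h = joint (\<lambda>z. f (act (fst z) 0 (snd z)) * h (act 1 (poly p (fst z)) (snd z)))" for h
  have J_halving: "J h = J f" if "h \<in> halvings T f" for h
    using that
  proof induction
    case (half h t)
    have hb: "bdd_fn h" using halvings_bdd[OF half.hyps(1) fb] .
    obtain y where y: "t = act 1 y" using half.hyps(2) by (auto simp: T_def)
    define D where "D v = h v - h (act 1 y v)" for v
    have Db: "bdd_fn D" unfolding D_def[abs_def] by (intro bdd_fn_diff hb bdd_fn_comp[OF hb])
    have "J (\<lambda>v. (h v + h (t v)) / 2) 
        = joint (\<lambda>z. f (act (fst z) 0 (snd z)) * h (act 1 (poly p (fst z)) (snd z))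
            - (1/2) * (f (act (fst z) 0 (snd z)) * D (act 1 (poly p (fst z)) (snd z))))"
      by (simp add: J_def y D_def field_simps)
    also have "\<dots> = J h 
        - (1/2) * joint (\<lambda>z. f (act (fst z) 0 (snd z)) * D (act 1 (poly p (fst z)) (snd z)))"
      by (simp only: J_def joint.scale joint.diff b bdd_fn_const bdd_fn_comp[OF hb] bdd_fn_comp[OF Db])
    also have "\<dots> = J h"
      using twisted_shift_annihilates[OF hb D_def deg char fb] by simp
    finally show ?case using half.IH by simp
  qed simp
  have "L (\<lambda>v. g (act u 0 v) * g v) - e 
      \<le> L (\<lambda>v. f (act u 0 v) * g (act 1 (poly p u) v))" if "u \<noteq> 0" for u
  proof -
    \<comment> \<open>A translation by \<open>y\<close> before the rescaling is one by \<open>y / u\<close> after it; the bound for \<open>g\<close> is uniform.\<close>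
    define h where "h v = g (act (1 / u) 0 v)" for v
    have hb: "bdd_fn h" unfolding h_def[abs_def] by (rule bdd_fn_comp[OF gb])
    have h_inv: "L (\<lambda>v. (h (t v) - h v)\<^sup>2) \<le> (e / 2)\<^sup>2" if t: "t \<in> T" for t
    proof -
      obtain y where y: "t = act 1 y" using t by (auto simp: T_def)
      have "L (\<lambda>v. (h (t v) - h v)\<^sup>2) 
          = L (\<lambda>v. (g (act 1 (y / u) (act (1 / u) 0 v)) - g (act (1 / u) 0 v))\<^sup>2)"
        by (simp add: h_def y act_act)
      also have "\<dots> = L (\<lambda>v. (g (act 1 (y / u) v) - g v)\<^sup>2)"
        using \<open>u \<noteq> 0\<close> by (intro preservesD[OF act_preserves[of "1 / u" 0]] bdd_fn_power b gb) auto
      also have "\<dots> \<le> (e / 2)\<^sup>2" by (intro g_inv) (simp add: T_def)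
      finally show ?thesis .
    qed
    have move: "L (\<lambda>v. k (act u 0 v) * g v) = L (\<lambda>v. k v * h v)" if "bdd_fn k" for k
      using preservesD[OF act_preserves[OF \<open>u \<noteq> 0\<close>, of 0] bdd_fn_mult[OF \<open>bdd_fn k\<close> hb]] \<open>u \<noteq> 0\<close>
      by (simp add: h_def act_act act_id)
    have "\<bar>L (\<lambda>v. g (act 1 0 v) * h v) - L (\<lambda>v. f v * h v)\<bar> \<le> e / 2"
      by (rule fibre.halvings_correlation[OF g f1 hb, where t = "act 1 0"])
        (fact e T T_comp h_inv id)+
    then have "L (\<lambda>v. g (act u 0 v) * g v) - e / 2 \<le> L (\<lambda>v. f (act u 0 v) * g v)"
      unfolding abs_diff_le_iff by (simp add: move gb fb act_id)
    moreover have "\<bar>L (\<lambda>v. f (act u 0 v) * (g (act 1 (poly p u) v) - g v))\<bar> \<le> e / 2"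
      using \<open>0 < e\<close> by (intro fibre.correlation_le f1 g_inv b gb) (auto simp: T_def)
    moreover have "L (\<lambda>v. f (act u 0 v) * (g (act 1 (poly p u) v) - g v))
        = L (\<lambda>v. f (act u 0 v) * g (act 1 (poly p u) v)) - L (\<lambda>v. f (act u 0 v) * g v)"
      by (simp add: fibre.diff[symmetric] b gb right_diff_distrib)
    ultimately show ?thesis by linarith
  qed
  moreover have slice_gg: "bdd_fn (\<lambda>u. L (\<lambda>v. g (act u 0 v) * g v))"
    using bdd_fn_slice_mean[OF fibre.mean_axioms,
        of "\<lambda>z. g (act (fst z) 0 (snd z)) * g (snd z)"] by (simp add: b)
  moreover have "bdd_fn (\<lambda>u. L (\<lambda>v. f (act u 0 v) * g (act 1 (poly p u) v)))"
    using bdd_fn_slice_mean[OF fibre.mean_axioms,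
        of "\<lambda>z. f (act (fst z) 0 (snd z)) * g (act 1 (poly p (fst z)) (snd z))"] by (simp add: b)
  ultimately have "m (\<lambda>u. L (\<lambda>v. g (act u 0 v) * g v) - e) \<le> J g"
    unfolding J_def joint_def fst_conv snd_conv
    by (intro mean_mono_nonzero bdd_fn_diff bdd_fn_const)
  moreover have "m (\<lambda>u. L (\<lambda>v. g (act u 0 v) * g v) - e) 
      = joint (\<lambda>z. g (act (fst z) 0 (snd z)) * g (snd z)) - e"
    using base.diff[OF slice_gg bdd_fn_const[of e]] by (simp add: joint_def base.const)
  moreover have "(L f)\<^sup>2 \<le> joint (\<lambda>z. g (act (fst z) 0 (snd z)) * g (snd z))"
    using multiplicative_recurrence[of g, OF g1] fibre.halvings_mean[OF g fb T] by simp
  ultimately show "(L f)\<^sup>2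
      \<le> joint (\<lambda>z. f (act (fst z) 0 (snd z)) * f (act 1 (poly p (fst z)) (snd z))) + e"
    using J_halving[OF g] by (simp add: J_def)
qed

end

section \<open>Invariant means from double Folner sequences\<close>

text \<open>A minimal proper filter decides every predicate, for adjoining an undecided one would refine it.\<close>

lemma exists_ultrafilter:
  fixes F :: "'x filter"
  assumes "F \<noteq> bot"
  obtains U where "U \<le> F" and "U \<noteq> bot"
    and "\<And>P. eventually P U \<or> eventually (\<lambda>x. \<not> P x) U"
proof -
  define A where "A = {G. G \<noteq> bot \<and> G \<le> F}"
  have "\<exists>M\<in>A. \<forall>G\<in>A. G \<le> M \<longrightarrow> G = M"
  proof (rule predicate_Zorn[where P = "\<lambda>G H. H \<le> G"])
    show "partial_order_on A (relation_of (\<lambda>G H. H \<le> G) A)"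
      by (rule partial_order_on_relation_ofI) auto
    fix C assume C: "C \<in> Chains (relation_of (\<lambda>G H. H \<le> G) A)"
    then have sub: "C \<subseteq> A" and total: "\<And>G H. G \<in> C \<Longrightarrow> H \<in> C \<Longrightarrow> G \<le> H \<or> H \<le> G"
      by (auto simp: Chains_def relation_of_def)
    show "\<exists>U\<in>A. \<forall>G\<in>C. U \<le> G"
    proof (cases "C = {}")
      case True
      then show ?thesis using assms by (auto simp: A_def)
    next
      case False
      have "eventually P (Inf C) \<longleftrightarrow> (\<exists>G\<in>C. eventually P G)" for P
        using total by (intro eventually_Inf_base False) (metis inf.absorb1 inf.absorb2 order_refl)
      then have "Inf C \<noteq> bot"
        using sub by (auto simp: trivial_limit_def A_def)
      moreover have "Inf C \<le> F" using False sub by (auto simp: A_def intro: Inf_lower2)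
      ultimately show ?thesis by (auto simp: A_def intro: Inf_lower)
    qed
  qed
  then obtain U where U: "U \<noteq> bot" "U \<le> F" and min: "\<And>G. G \<noteq> bot \<Longrightarrow> G \<le> U \<Longrightarrow> G = U"
    by (auto simp: A_def intro: order.trans)
  have ultra: "eventually P U \<or> eventually (\<lambda>x. \<not> P x) U" for P
  proof (cases "inf U (principal {x. P x}) = bot")
    case True
    then show ?thesis by (simp add: trivial_limit_def eventually_inf_principal)
  next
    case False
    then have "inf U (principal {x. P x}) = U" by (intro min) auto
    then have "U \<le> principal {x. P x}" by (metis inf.cobounded2)
    then show ?thesis by (simp add: le_principal)
  qed
  show thesis by (rule that[OF U(2,1) ultra])
qed

lemma ultrafilter_bounded_limit:
  fixes s :: "'i \<Rightarrow> real"
  assumes "U \<noteq> bot" and ultra: "\<And>P. eventually P U \<or> eventually (\<lambda>x. \<not> P x) U"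
    and "\<And>i. \<bar>s i\<bar> \<le> B"
  obtains l where "(s \<longlongrightarrow> l) U"
proof -
  have "s i \<in> {-B..B}" for i using assms(3)[of i] by (simp add: abs_le_iff)
  then have "eventually (\<lambda>x. x \<in> {-B..B}) (filtermap s U)" by (simp add: eventually_filtermap)
  moreover have "filtermap s U \<noteq> bot" using \<open>U \<noteq> bot\<close> by (simp add: filtermap_bot_iff)
  ultimately obtain l where l: "inf (nhds l) (filtermap s U) \<noteq> bot"
    using compact_Icc[of "-B" B] unfolding compact_filter by blast
  have "(s \<longlongrightarrow> l) U"
  proof (rule topological_tendstoI)
    fix S assume S: "open S" "l \<in> S"
    have "\<not> eventually (\<lambda>i. s i \<notin> S) U"
    proof
      assume "eventually (\<lambda>i. s i \<notin> S) U"
      then have "eventually (\<lambda>x. x \<notin> S) (filtermap s U)" by (simp add: eventually_filtermap)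
      moreover have "eventually (\<lambda>x. x \<in> S) (nhds l)" using S by (rule eventually_nhds_in_open)
      ultimately have "eventually (\<lambda>x. False) (inf (nhds l) (filtermap s U))"
        unfolding eventually_inf by blast
      with l show False by (simp add: trivial_limit_def)
    qed
    then show "eventually (\<lambda>i. s i \<in> S) U" using ultra by blast
  qed
  then show thesis by (rule that)
qed

lemma sum_image_diff_le:
  assumes "finite A" and "inj t" and "\<And>x. \<bar>g x\<bar> \<le> B"
  shows "\<bar>(\<Sum>x\<in>A. g (t x)) - (\<Sum>x\<in>A. g x)\<bar> \<le> 2 * B * (real (card A) - real (card (A \<inter> t ` A)))"
proof -
  have inj: "inj_on t A" using \<open>inj t\<close> by (rule inj_on_subset) simp
  have fin: "finite (t ` A)" using assms(1) by simp
  have tail: "\<bar>sum g (X - Y)\<bar> \<le> B * (real (card X) - real (card (X \<inter> Y)))" if "finite X" for X Y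
  proof -
    have "\<bar>sum g (X - Y)\<bar> \<le> (\<Sum>x\<in>X - Y. \<bar>g x\<bar>)" by (rule sum_abs)
    also have "\<dots> \<le> real (card (X - Y)) * B" by (rule sum_bounded_above) (rule assms)
    also have "real (card (X - Y)) = real (card X) - real (card (X \<inter> Y))"
      using that by (simp add: card_Diff_subset_Int of_nat_diff card_mono)
    finally show ?thesis by (simp add: mult.commute)
  qed
  have "(\<Sum>x\<in>A. g (t x)) = sum g (t ` A)" using inj by (simp add: sum.reindex)
  also have "\<dots> = sum g (t ` A \<inter> A) + sum g (t ` A - A)" by (rule sum.Int_Diff[OF fin])
  finally have "(\<Sum>x\<in>A. g (t x)) = sum g (A \<inter> t ` A) + sum g (t ` A - A)" by (simp add: Int_commute)
  moreover have "sum g A = sum g (A \<inter> t ` A) + sum g (A - t ` A)" by (rule sum.Int_Diff[OF assms(1)])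
  moreover have "\<bar>sum g (t ` A - A)\<bar> \<le> B * (real (card A) - real (card (A \<inter> t ` A)))"
    using tail[OF fin, of A] inj by (simp add: card_image Int_commute)
  ultimately show ?thesis using tail[OF assms(1), of "t ` A"] by linarith
qed

text \<open>Limits of the averages over the sets \<open>F N\<close> along an ultrafilter exist for all bounded functions
  at once, which makes the limit additive; upper densities alone are only subadditive. Invariance is
  the Folner property, and a limit along a finer filter is at most the upper limit.\<close>

lemma invariant_mean_exists:
  fixes F :: "nat \<Rightarrow> 'a::field set"
  assumes "double_Folner F"
  obtains m where "mean m" and "\<And>a b. a \<noteq> 0 \<Longrightarrow> preserves m (\<lambda>x. a * x + b)"
    and "\<And>E. 0 < m (indicat_real E) \<Longrightarrow> 0 < upper_density F E"
proof -
  have fin: "finite (F N)" and card: "0 < card (F N)" for N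
    using assms by (auto simp: double_Folner_def card_gt_0_iff)
  obtain U where U: "U \<le> sequentially" "U \<noteq> bot"
    and ultra: "\<And>P. eventually P U \<or> eventually (\<lambda>x. \<not> P x) U"
    using exists_ultrafilter[OF sequentially_bot] by metis
  define avg where "avg g N = (\<Sum>x\<in>F N. g x) / real (card (F N))" for g :: "'a \<Rightarrow> real" and N
  define m where "m g = Lim U (avg g)" for g
  have lim: "(avg g \<longlongrightarrow> m g) U" if "bdd_fn g" for g
  proof -
    from that obtain B where B: "\<And>x. \<bar>g x\<bar> \<le> B" by (auto simp: bdd_fn_def)
    have "\<bar>avg g N\<bar> \<le> B" for N
    proof -
      have "\<bar>\<Sum>x\<in>F N. g x\<bar> \<le> (\<Sum>x\<in>F N. \<bar>g x\<bar>)" by (rule sum_abs)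
      also have "\<dots> \<le> real (card (F N)) * B" by (rule sum_bounded_above) (rule B)
      finally show ?thesis using card[of N] by (simp add: avg_def abs_divide field_simps)
    qed
    then obtain l where "(avg g \<longlongrightarrow> l) U" by (rule ultrafilter_bounded_limit[OF U(2) ultra])
    with tendsto_Lim[OF U(2) this] show ?thesis by (simp add: m_def)
  qed
  have m_eq: "m g = l" if "bdd_fn g" "(avg g \<longlongrightarrow> l) U" for g l
    using tendsto_unique[OF U(2) lim[OF that(1)] that(2)] .
  have mean: "mean m"
  proof
    fix f g :: "'a \<Rightarrow> real" and c
    assume f: "bdd_fn f"
    show "m (\<lambda>x. c * f x) = c * m f"
      using tendsto_mult_left[OF lim[OF f], of c] 
      by (intro m_eq bdd_fn_intros f) (simp add: avg_def[abs_def] sum_distrib_left)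
    show "0 \<le> m f" if "\<And>x. 0 \<le> f x"
      using lim[OF f] U(2) that 
      by (intro tendsto_lowerbound) (auto simp: avg_def intro!: always_eventually sum_nonneg divide_nonneg_nonneg)
    assume g: "bdd_fn g"
    show "m (\<lambda>x. f x + g x) = m f + m g"
      using tendsto_add[OF lim[OF f] lim[OF g]]
      by (intro m_eq bdd_fn_intros f g) (simp add: avg_def[abs_def] sum.distrib add_divide_distrib)
  next
    have "avg (\<lambda>x. 1) N = 1" for N using card[of N] by (simp add: avg_def)
    then have "avg (\<lambda>x. 1) = (\<lambda>N. 1)" by auto
    then show "m (\<lambda>x. 1) = 1" by (intro m_eq bdd_fn_const) simp
  qed
  have Folner: "preserves m t"
    if "inj t" and conv: "(\<lambda>N. real (card (F N \<inter> t ` F N)) / real (card (F N))) \<longlonglongrightarrow> 1" for t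
    unfolding preserves_def
  proof (intro allI impI)
    fix g :: "'a \<Rightarrow> real" assume g: "bdd_fn g"
    then obtain B where B: "\<And>x. \<bar>g x\<bar> \<le> B" by (auto simp: bdd_fn_def)
    define q where "q N = real (card (F N \<inter> t ` F N)) / real (card (F N))" for N
    have q: "(q \<longlongrightarrow> 1) U" using tendsto_mono[OF U(1) conv] by (simp add: q_def[abs_def])
    have bound: "\<bar>avg (\<lambda>x. g (t x)) N - avg g N\<bar> \<le> 2 * B * (1 - q N)" for N
    proof -
      have c: "0 < real (card (F N))" using card[of N] by simp
      have "\<bar>avg (\<lambda>x. g (t x)) N - avg g N\<bar>
          = \<bar>(\<Sum>x\<in>F N. g (t x)) - (\<Sum>x\<in>F N. g x)\<bar> / real (card (F N))"
        using c by (simp add: avg_def diff_divide_distrib[symmetric] abs_divide)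
      also have "\<dots> \<le> 2 * B * (real (card (F N)) - real (card (F N \<inter> t ` F N))) / real (card (F N))"
        by (intro divide_right_mono sum_image_diff_le fin \<open>inj t\<close> B) simp
      also have "\<dots> = 2 * B * (1 - q N)" using c by (simp add: q_def field_simps)
      finally show ?thesis .
    qed
    have "((\<lambda>N. 2 * B * (1 - q N)) \<longlongrightarrow> 2 * B * (1 - 1)) U" by (intro tendsto_intros q)
    then have "((\<lambda>N. 2 * B * (1 - q N)) \<longlongrightarrow> 0) U" by simp
    then have "((\<lambda>N. avg (\<lambda>x. g (t x)) N - avg g N) \<longlongrightarrow> 0) U"
      by (rule Lim_null_comparison[rotated]) (auto simp: bound)
    from tendsto_add[OF this lim[OF g]] show "m (\<lambda>x. g (t x)) = m g"
      by (intro m_eq bdd_fn_comp[OF g]) simp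
  qed
  have affine: "preserves m (\<lambda>x. a * x + b)" if "a \<noteq> 0" for a b
  proof -
    have a: "preserves m (\<lambda>x. a * x)"
      using assms that by (intro Folner injI) (auto simp: double_Folner_def)
    have "preserves m (\<lambda>x. b + x)" 
    proof (cases "b = 0")
      case False
      then show ?thesis using assms by (intro Folner injI) (auto simp: double_Folner_def)
    qed (simp add: preserves_def)
    then have "m (\<lambda>x. g (a * x + b)) = m g" if "bdd_fn g" for g
      using preservesD[OF a bdd_fn_comp[OF that, of "\<lambda>x. b + x"]] preservesD[of m "\<lambda>x. b + x", OF _ that]
      by (simp add: add.commute)
    then show ?thesis by (simp add: preserves_def)
  qed
  have density: "0 < upper_density F E" if "0 < m (indicat_real E)" for E
  proof -
    define d where "d N = ereal (real (card (E \<inter> F N)) / real (card (F N)))" for N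
    have "ereal (avg (indicat_real E) N) = d N" for N
      using fin by (simp add: avg_def d_def indicator_def sum_of_bool_eq Int_commute)
    then have "((\<lambda>N. d N) \<longlongrightarrow> ereal (m (indicat_real E))) U"
      using tendsto_ereal[OF lim[OF bdd_fn_indicator, of E]] by simp
    then have "ereal (m (indicat_real E)) = Limsup U d"
      by (rule lim_imp_Limsup[OF U(2), symmetric])
    also have "Limsup U d \<le> limsup d"
      unfolding Limsup_def using U(1) by (intro INF_superset_mono order_refl) (auto simp: le_filter_def)
    also have "limsup d = upper_density F E" by (simp add: upper_density_def d_def[abs_def])
    finally have "ereal (m (indicat_real E)) \<le> upper_density F E" .
    with that show ?thesis by (metis ereal_less(2) order.strict_trans2)
  qed
  show thesis by (rule that[OF mean affine density])
qed

section \<open>Powers of an invariant mean\<close>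

text \<open>The iterated mean \<open>m \<otimes> \<dots> \<otimes> m\<close>; lists serve as points of the power because their length may
  depend on the colouring.\<close>
primrec list_mean :: "(('a \<Rightarrow> real) \<Rightarrow> real) \<Rightarrow> nat \<Rightarrow> ('a list \<Rightarrow> real) \<Rightarrow> real" where
  "list_mean m 0 g = g []"
| "list_mean m (Suc k) g = m (\<lambda>x. list_mean m k (\<lambda>xs. g (x # xs)))"

lemma mean_list_mean:
  assumes "mean m"
  shows "mean (list_mean m k)"
proof (induction k)
  case 0
  show ?case by unfold_locales simp_all
next
  case (Suc k)
  interpret P: mean "\<lambda>f. m (\<lambda>x. list_mean m k (\<lambda>xs. f (x, xs)))"
    using assms Suc by (rule mean_product)
  show ?case
  proof
    fix f g :: "'a list \<Rightarrow> real" and c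
    let ?c = "\<lambda>z. fst z # snd z"
    assume f: "bdd_fn f"
    show "list_mean m (Suc k) (\<lambda>x. c * f x) = c * list_mean m (Suc k) f"
      using P.scale[OF bdd_fn_comp[OF f, of ?c], of c] by simp
    show "0 \<le> list_mean m (Suc k) f" if "\<And>x. 0 \<le> f x"
      using P.nonneg[OF bdd_fn_comp[OF f, of ?c]] that by simp
    assume g: "bdd_fn g"
    show "list_mean m (Suc k) (\<lambda>x. f x + g x) = list_mean m (Suc k) f + list_mean m (Suc k) g"
      using P.add[OF bdd_fn_comp[OF f, of ?c] bdd_fn_comp[OF g, of ?c]] by simp
  qed (use P.one in simp)
qed

lemma list_mean_preserves:
  assumes m: "mean m" and t: "preserves m t"
  shows "preserves (list_mean m k) (map t)"
proof (induction k)
  case 0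
  show ?case by (simp add: preserves_def)
next
  case (Suc k)
  show ?case unfolding preserves_def
  proof (intro allI impI)
    fix g :: "'a list \<Rightarrow> real" assume g: "bdd_fn g"
    have "list_mean m k (\<lambda>xs. g (t x # map t xs)) = list_mean m k (\<lambda>xs. g (t x # xs))" for x
      using preservesD[OF Suc bdd_fn_comp[OF g, of "\<lambda>xs. t x # xs"]] .
    moreover have "bdd_fn (\<lambda>x. list_mean m k (\<lambda>xs. g (x # xs)))"
      using bdd_fn_slice_mean[OF mean_list_mean[OF m] bdd_fn_comp[OF g, of "\<lambda>z. fst z # snd z"]] by simp
    ultimately show "list_mean m (Suc k) (\<lambda>xs. g (map t xs)) = list_mean m (Suc k) g"
      using preservesD[OF t] by simp
  qed
qed

text \<open>A tensor stops at the shorter of its two arguments, so the bounds and identities below hold for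
  lists of every length; only the mean of a tensor needs lists as long as the family of functions.\<close>
definition tensor :: "('a \<Rightarrow> real) list \<Rightarrow> 'a list \<Rightarrow> real" where
  "tensor hs xs = (\<Prod>(h, x)\<leftarrow>zip hs xs. h x)"

lemma tensor_Cons: "tensor (h # hs) (x # xs) = h x * tensor hs xs"
  by (simp add: tensor_def)

lemma tensor_abs_le:
  assumes "\<And>h x. h \<in> set hs \<Longrightarrow> \<bar>h x\<bar> \<le> 1"
  shows "\<bar>tensor hs xs\<bar> \<le> 1"
  using assms
proof (induction hs arbitrary: xs)
  case (Cons h hs)
  have "\<bar>tensor hs ys\<bar> \<le> 1" for ys by (intro Cons) simp
  then show ?case using Cons.prems[of h]
    by (cases xs) (auto simp: tensor_def abs_mult intro!: mult_le_one)
qed (simp add: tensor_def)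

lemma tensor_mult:
  "tensor hs (map a xs) * tensor hs (map b xs) = tensor (map (\<lambda>h x. h (a x) * h (b x)) hs) xs"
proof (induction hs arbitrary: xs)
  case (Cons h hs)
  then show ?case by (cases xs) (auto simp: tensor_def algebra_simps)
qed (simp add: tensor_def)

lemma list_mean_tensor:
  assumes m: "mean m" and "\<And>h x. h \<in> set hs \<Longrightarrow> \<bar>h x\<bar> \<le> 1"
  shows "list_mean m (length hs) (tensor hs) = (\<Prod>h\<leftarrow>hs. m h)"
  using assms(2)
proof (induction hs)
  case (Cons h hs)
  interpret m: mean m by fact
  interpret L: mean "list_mean m (length hs)" using m by (rule mean_list_mean)
  have "bdd_fn (tensor hs)" by (rule bdd_fnI, rule tensor_abs_le) (use Cons.prems in simp)
  moreover have "bdd_fn h" by (rule bdd_fnI, rule Cons.prems) simp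
  ultimately show ?case
    using Cons m.scale[of h "\<Prod>h\<leftarrow>hs. m h"] by (simp add: tensor_Cons L.scale mult.commute)
qed (simp add: tensor_def)

section \<open>Monochromatic patterns\<close>

text \<open>Ensures that repeated differences of \<open>p\<close> lose exactly one degree at a time.\<close>

lemma of_nat_nonzero_if_admissible:
  fixes p :: "'a::field poly"
  assumes "admissible p" and "0 < k" and "k \<le> degree p"
  shows "of_nat k \<noteq> (0::'a)"
proof (cases "CHAR('a) = 0")
  case False
  then have "degree p < CHAR('a)" using assms(1) by (auto simp: admissible_def prime_gt_0_nat)
  then show ?thesis using assms(2,3) by (auto simp: of_nat_eq_0_iff_char_dvd dest: dvd_imp_le)
qed (use assms(2) in \<open>simp add: of_nat_eq_0_iff_char_dvd\<close>)

theorem theorem1p11: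
  fixes F :: "nat \<Rightarrow> 'a::field set" and p :: "'a poly"
    and r :: nat and C :: "nat \<Rightarrow> 'a set"
  assumes "countable (UNIV :: 'a set)" and "infinite (UNIV :: 'a set)"
    and "double_Folner F"
    and "degree p > 0" and "admissible p"
    and "(UNIV :: 'a set) = (\<Union>i\<in>{1..r}. C i)"
  shows "\<exists>j\<in>{1..r}.
    upper_density F
      {u \<in> C j. upper_density F {v. {u, poly p u + v, u * v} \<subseteq> C j} > 0} > 0"
proof (rule ccontr)
  define G where "G j = {u \<in> C j. upper_density F {v. {u, poly p u + v, u * v} \<subseteq> C j} > 0}" for j
  assume "\<not> ?thesis"
  then have not_G: "\<not> 0 < upper_density F (G j)" if "j \<in> {1..r}" for j
    using that by (auto simp: G_def)
  obtain m where m: "mean m" and m_inv: "\<And>a b. a \<noteq> 0 \<Longrightarrow> preserves m (\<lambda>x. a * x + b)"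
    and density: "\<And>E. 0 < m (indicat_real E) \<Longrightarrow> 0 < upper_density F E"
    by (rule invariant_mean_exists[OF assms(3)]) (rule that)
  interpret m: mean m by fact
  have ind_nonneg: "0 \<le> m (indicat_real E)" for E
    by (intro m.nonneg bdd_fn_indicator) simp
  \<comment> \<open>A colour of mean zero must be left out: it would make the mean of the tensor vanish.\<close>
  define js where "js = filter (\<lambda>j. 0 < m (indicat_real (C j))) [1..<Suc r]"
  define hs where "hs = map (\<lambda>j. indicat_real (C j)) js"
  define L where "L = list_mean m (length hs)"
  define act where "act a b = map (\<lambda>x::'a. a * x + b)" for a b
  interpret affine_system m L act
  proof (intro affine_system.intro affine_system_axioms.intro)
    show "mean L" unfolding L_def by (rule mean_list_mean[OF m])
    show "preserves L (act a b)" if "a \<noteq> 0" for a b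
      unfolding L_def act_def by (rule list_mean_preserves[OF m m_inv[OF that]])
    show "infinite (UNIV :: 'a set)" by fact
    show "preserves m (\<lambda>x. a * x + b)" if "a \<noteq> 0" for a b using m_inv[OF that] .
  qed (auto simp: act_def algebra_simps m intro: map_idI)
  define D where "D j u = {v. u * v \<in> C j \<and> poly p u + v \<in> C j}" for j u
  \<comment> \<open>\<open>\<Phi> u\<close> is positive only if \<open>u\<close> works for all colours of positive mean simultaneously.\<close>
  define \<Phi> where "\<Phi> u = L (\<lambda>v. tensor hs (act u 0 v) * tensor hs (act 1 (poly p u) v))" for u
  have hs1: "\<bar>h x\<bar> \<le> 1" if "h \<in> set hs" for h x
    using that by (auto simp: hs_def indicator_def)
  have tensor1: "\<bar>tensor hs v\<bar> \<le> 1" for v using hs1 by (rule tensor_abs_le)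
  have \<Phi>_eq: "\<Phi> u = (\<Prod>j\<leftarrow>js. m (indicat_real (D j u)))" for u
  proof -
    let ?hs = "map (\<lambda>h x. h (u * x + 0) * h (1 * x + poly p u)) hs"
    have "\<Phi> u = list_mean m (length ?hs) (tensor ?hs)"
      by (simp add: \<Phi>_def L_def act_def tensor_mult del: mult_1 add_0_right)
    also have "\<dots> = (\<Prod>h\<leftarrow>?hs. m h)"
      by (rule list_mean_tensor[OF m]) (auto simp: hs_def indicator_def)
    also have "?hs = map (\<lambda>j. indicat_real (D j u)) js"
      by (auto simp: hs_def D_def indicator_def add.commute fun_eq_iff)
    finally show ?thesis by (simp add: o_def)
  qed
  have \<Phi>1: "\<bar>\<Phi> u\<bar> \<le> 1" for u
    unfolding \<Phi>_def using tensor1 by (intro fibre.abs_le) (simp add: abs_mult mult_le_one)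
  have prod_pos: "0 < (\<Prod>h\<leftarrow>hs. m h)" if "\<forall>h\<in>set hs. 0 < m h" for hs
    using that by (induction hs) auto
  have "L (tensor hs) = (\<Prod>h\<leftarrow>hs. m h)"
    unfolding L_def using m hs1 by (rule list_mean_tensor)
  also have "\<dots> > 0" using prod_pos[of hs] by (auto simp: hs_def js_def)
  finally have "0 < (L (tensor hs))\<^sup>2" by simp
  also have "\<dots> \<le> joint (\<lambda>z. tensor hs (act (fst z) 0 (snd z))
      * tensor hs (act 1 (poly p (fst z)) (snd z)))"
    using \<open>degree p > 0\<close> of_nat_nonzero_if_admissible[OF \<open>admissible p\<close>]
    by (intro affine_recurrence[where n = "degree p - 1"] tensor1) auto
  also have "\<dots> = m \<Phi>" by (simp add: joint_def \<Phi>_def[abs_def])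
  \<comment> \<open>Where \<open>\<Phi> u\<close> is positive, a colour of \<open>u\<close> either has mean zero or is good at \<open>u\<close>.\<close>
  also have "\<dots> \<le> m (\<lambda>u. \<Sum>j\<in>{1..r}. indicat_real (if j \<in> set js then G j else C j) u)"
  proof (rule m.mono)
    fix u
    obtain j where j: "j \<in> {1..r}" "u \<in> C j" using assms(6) by blast
    have "u \<in> G j" if "j \<in> set js" "0 < \<Phi> u"
    proof -
      have "0 \<notin> set (map (\<lambda>j. m (indicat_real (D j u))) js)"
        using that(2) unfolding \<Phi>_eq prod_list_zero_iff[symmetric] by simp
      then have "m (indicat_real (D j u)) \<noteq> 0" using that(1) by (force simp: image_iff)
      then have "0 < upper_density F (D j u)" 
        using ind_nonneg[of "D j u"] by (intro density) simp
      moreover have "D j u = {v. {u, poly p u + v, u * v} \<subseteq> C j}" using j by (auto simp: D_def)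
      ultimately show ?thesis using j by (simp add: G_def)
    qed
    then have "\<Phi> u \<le> indicat_real (if j \<in> set js then G j else C j) u"
      using \<Phi>1[of u] j by (cases "0 < \<Phi> u") (auto simp: indicator_def abs_le_iff)
    also have "\<dots> \<le> (\<Sum>j\<in>{1..r}. indicat_real (if j \<in> set js then G j else C j) u)"
      using j by (intro member_le_sum) auto
    finally show "\<Phi> u \<le> (\<Sum>j\<in>{1..r}. indicat_real (if j \<in> set js then G j else C j) u)" .
  qed (auto intro!: bdd_fn_sum bdd_fn_indicator bdd_fnI[OF \<Phi>1])
  also have "\<dots> = (\<Sum>j\<in>{1..r}. m (indicat_real (if j \<in> set js then G j else C j)))"
    by (intro m.sum bdd_fn_indicator) simp
  also have "\<dots> \<le> 0"
  proof (intro sum_nonpos)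
    fix j assume j: "j \<in> {1..r}"
    show "m (indicat_real (if j \<in> set js then G j else C j)) \<le> 0"
    proof (cases "j \<in> set js")
      case True
      then show ?thesis using not_G[OF j] density[of "G j"] by (simp add: not_less[symmetric]) blast
    next
      case False
      then show ?thesis using j by (auto simp: js_def)
    qed
  qed
  finally show False by simp
qed

end
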